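(* Let $f:(\{0,1\}^n)^k\to\{0,1\}$ be a $k$-argument boolean function, $G=([k],E)$ a restriction graph, $Q$ an oblivious $k$-party $\mathrm{NOF}_G$ protocol computing $f$, and $\Pi=\pi_1,\dots,\pi_\ell$ a sequence of permutations of $[k]$ with $\pi_1$ the identity. Assume that for every $2\le i\le \ell$, $Q$ is $\pi_i$-pattern-robust, and let $S$ be a $(\Pi,G)$-multiplexing set. Then $$D^{\mathrm{NOF}}(f^{\ell})\le \ell\cdot D^{\mathrm{NOF}_G}(Q)+\ell-\sum_{(a,b,R)\in S}|R|\cdot W_Q(a,b).$$
   Context: NOF model and $D^{\mathrm{NOF}}$: $k$ parties; input $x_j\in\{0,1\}^n$ is seen by all parties except $P_j$; parties write bits on a shared board; all parties must learn the output; $D^{\mathrm{NOF}}(g)$ is the minimum over deterministic NOF protocols for $g$ of the worst-case number of bits written. $f^{\ell}$: computing $f$ on $\ell$ independent instances, where the $j$-th argument $x_{i,j}$ of instance $i$ is on $P_j$'s forehead; all parties must learn all $\ell$ outputs. Restricted model: a restriction graph is a simple directed graph $G=(V,E)$ on $V=[k]$ (no loops). In the $\mathrm{NOF}_G$ model, party $P_i$ sees input $x_j$ iff $(i,j)\in E$. Communication is over private point-to-point channels between every pair of parties, in rounds: in round $t+1$ each $P_i$ may send to each $P_j$ (even if $(i,j)\notin E$) a message depending on the messages $P_i$ received in rounds $1,\dots,t$ and on the inputs $P_i$ sees. A $\mathrm{NOF}_G$ protocol computes $f$ if some fixed designated party outputs $f(\vec x)$. $N_G(a)=\{j:(a,j)\in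 E\}$ and $\overline{N_G(a)}=V\setminus N_G(a)$. A protocol $Q$ is oblivious if there is a map $\mathrm{LEN}^Q:\mathbb N\times[k]\times[k]\to\mathbb N$ such that on every input the message from $P_i$ to $P_j$ in round $t$ has length $\mathrm{LEN}^Q(t,i,j)$. For oblivious $Q$, $W_Q(a,b)$ is the total number of bits sent from $P_a$ to $P_b$ in $Q$, and $D^{\mathrm{NOF}_G}(Q)$ is the total number of bits sent in $Q$. For a permutation $\pi$ of $[k]$, $G_\pi=([k],\{(\pi(i),\pi(j)):(i,j)\in E\})$. $Q$ is $\pi$-pattern-robust if there is an oblivious $\mathrm{NOF}_{G_\pi}$ protocol $Q'$ computing $f$ with $\mathrm{LEN}^{Q'}(t,i,j)=\mathrm{LEN}^Q(t,\pi^{-1}(i),\pi^{-1}(j))$ for all $t,i,j$. For $b\in[k]$ and $R\subseteq[\ell]$, $\mathrm{MAP}_{\Pi,b,R}=\{\pi_r(b):r\in R\}$. A triple $(a,b,R)$ with $a\ne b\in[k]$, $R\subseteq[\ell]$ is $(\Pi,G)$-good if: (1) $\mathrm{MAP}_{\Pi,a,R}=\{a\}$; (2) $\mathrm{MAP}_{\Pi,b,R}$ is a subset of $\overline{N_G(a)}$ of size $|R|$ containing neither $a$ nor $b$; (3) for all $r\in R$, $(\mathrm{MAP}_{\Pi,b,R}\cup\{b\})\setminus\{\pi_r(b)\}\subseteq\overline{N_{G_{\pi_r}}(a)}$. A $(\Pi,G)$-multiplexing set is a collection $S$ of $(\Pi,G)$-good triples such that for any two distinct $(a,b,R),(a',b',R')\in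 S$: $a\notin\{b'\}\cup\mathrm{MAP}_{\Pi,b',R'}$ and $(\{b\}\cup\mathrm{MAP}_{\Pi,b,R})\cap(\{b'\}\cup\mathrm{MAP}_{\Pi,b',R'})=\emptyset$. *)

theory Defs
  imports "HOL-Combinatorics.Permutations" "HOL-Library.Extended_Real" "HOL-Library.FuncSet"
begin

text \<open>
  The parties are \<open>1, \<dots>, k\<close>. An input is a function on \<open>{1..k}\<close> (extensional, so that it
  carries no information elsewhere), and the part of an input \<open>x\<close> that is visible to a party
  seeing the coordinates in \<open>A\<close> is \<open>restrict x A\<close>.
\<close>

definition strings :: "nat \<Rightarrow> bool list set" where
  "strings n = {w. length w = n}"

definition inputs :: "nat \<Rightarrow> 'x set \<Rightarrow> (nat \<Rightarrow> 'x) set" where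
  "inputs k X = ({1..k} \<rightarrow>\<^sub>E X)"

text \<open>
  A protocol is a tree whose position is the current board content. At \<open>Write i m P0 P1\<close> party
  \<open>i\<close> writes the bit that \<open>m\<close> computes from what \<open>i\<close> sees. At a leaf, \<open>Stop out\<close>, party \<open>i\<close>
  outputs \<open>out i\<close> applied to what \<open>i\<close> sees.
\<close>

datatype ('x, 'o) nof_protocol =
    Stop "nat \<Rightarrow> (nat \<Rightarrow> 'x) \<Rightarrow> 'o"
  | Write nat "(nat \<Rightarrow> 'x) \<Rightarrow> bool" "('x, 'o) nof_protocol" "('x, 'o) nof_protocol"

definition nof_view :: "nat \<Rightarrow> (nat \<Rightarrow> 'x) \<Rightarrow> nat \<Rightarrow> (nat \<Rightarrow> 'x)" where
  "nof_view k x i = restrict x ({1..k} - {i})"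

primrec nof_wf :: "nat \<Rightarrow> ('x, 'o) nof_protocol \<Rightarrow> bool" where
  "nof_wf k (Stop out) \<longleftrightarrow> True"
| "nof_wf k (Write i m P0 P1) \<longleftrightarrow> i \<in> {1..k} \<and> nof_wf k P0 \<and> nof_wf k P1"

primrec nof_output :: "nat \<Rightarrow> ('x, 'o) nof_protocol \<Rightarrow> (nat \<Rightarrow> 'x) \<Rightarrow> nat \<Rightarrow> 'o" where
  "nof_output k (Stop out) x p = out p (nof_view k x p)"
| "nof_output k (Write i m P0 P1) x p =
     (if m (nof_view k x i) then nof_output k P1 x p else nof_output k P0 x p)"

primrec nof_bits :: "nat \<Rightarrow> ('x, 'o) nof_protocol \<Rightarrow> (nat \<Rightarrow> 'x) \<Rightarrow> nat" where
  "nof_bits k (Stop out) x = 0"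
| "nof_bits k (Write i m P0 P1) x =
     Suc (if m (nof_view k x i) then nof_bits k P1 x else nof_bits k P0 x)"

definition nof_computes ::
    "nat \<Rightarrow> 'x set \<Rightarrow> ('x, 'o) nof_protocol \<Rightarrow> ((nat \<Rightarrow> 'x) \<Rightarrow> 'o) \<Rightarrow> bool" where
  "nof_computes k X P g \<longleftrightarrow>
     nof_wf k P \<and> (\<forall>x\<in>inputs k X. \<forall>p\<in>{1..k}. nof_output k P x p = g x)"

text \<open>The value is \<open>\<infinity>\<close> if no protocol computes \<open>g\<close>; otherwise the infimum is a minimum.\<close>

definition D_NOF :: "nat \<Rightarrow> 'x set \<Rightarrow> ((nat \<Rightarrow> 'x) \<Rightarrow> 'o) \<Rightarrow> enat" where
  "D_NOF k X g =
     (INF P\<in>{P. nof_computes k X P g}. SUP x\<in>inputs k X. enat (nof_bits k P x))"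

text \<open>
  For \<open>l\<close> independent instances, the forehead input \<open>y j\<close> of party \<open>j\<close> is the family
  of the \<open>j\<close>-th arguments \<open>y j i\<close> of the instances \<open>i \<in> {1..l}\<close>.
\<close>

definition multi_strings :: "nat \<Rightarrow> nat \<Rightarrow> (nat \<Rightarrow> bool list) set" where
  "multi_strings l n = ({1..l} \<rightarrow>\<^sub>E strings n)"

definition multi ::
    "nat \<Rightarrow> nat \<Rightarrow> ((nat \<Rightarrow> bool list) \<Rightarrow> bool) \<Rightarrow> (nat \<Rightarrow> nat \<Rightarrow> bool list) \<Rightarrow> (nat \<Rightarrow> bool)" where
  "multi k l f y = (\<lambda>i\<in>{1..l}. f (\<lambda>j\<in>{1..k}. y j i))"

definition restriction_graph :: "nat \<Rightarrow> (nat \<times> nat) set \<Rightarrow> bool" where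
  "restriction_graph k E \<longleftrightarrow> E \<subseteq> {1..k} \<times> {1..k} \<and> irrefl E"

definition nbrs :: "(nat \<times> nat) set \<Rightarrow> nat \<Rightarrow> nat set" where
  "nbrs E a = {j. (a, j) \<in> E}"

definition non_nbrs :: "nat \<Rightarrow> (nat \<times> nat) set \<Rightarrow> nat \<Rightarrow> nat set" where
  "non_nbrs k E a = {1..k} - nbrs E a"

definition permuted_graph :: "(nat \<Rightarrow> nat) \<Rightarrow> (nat \<times> nat) set \<Rightarrow> (nat \<times> nat) set" where
  "permuted_graph \<pi> E = (\<lambda>(i, j). (\<pi> i, \<pi> j)) ` E"

text \<open>
  \<open>msg Q t i j v h\<close> is the message from \<open>i\<close> to \<open>j\<close> in round \<open>t \<in> {1..rounds Q}\<close>, where \<open>v\<close> is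
  the part of the input seen by \<open>i\<close> and \<open>h s p\<close> is the message that \<open>i\<close> received from \<open>p\<close> in
  round \<open>s\<close>. After the last round the party \<open>answerer Q\<close> outputs \<open>answer Q v h\<close>.
\<close>

record protocol =
  rounds :: nat
  msg :: "nat \<Rightarrow> nat \<Rightarrow> nat \<Rightarrow> (nat \<Rightarrow> bool list) \<Rightarrow> (nat \<Rightarrow> nat \<Rightarrow> bool list) \<Rightarrow> bool list"
  answerer :: nat
  answer :: "(nat \<Rightarrow> bool list) \<Rightarrow> (nat \<Rightarrow> nat \<Rightarrow> bool list) \<Rightarrow> bool"

text \<open>
  The message actually sent on input \<open>x\<close>. It is empty outside the rounds of the protocol, and
  there is no channel from a party to itself.
\<close>

fun sent ::
    "nat \<Rightarrow> (nat \<times> nat) set \<Rightarrow> protocol \<Rightarrow> (nat \<Rightarrow> bool list) \<Rightarrow> nat \<Rightarrow> nat \<Rightarrow> nat \<Rightarrow> bool list" where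
  "sent k E Q x t i j =
     (if t \<in> {1..rounds Q} \<and> i \<in> {1..k} \<and> j \<in> {1..k} \<and> i \<noteq> j
      then msg Q t i j (restrict x (nbrs E i)) (\<lambda>s p. if s < t then sent k E Q x s p i else [])
      else [])"

declare sent.simps [simp del]

definition computes ::
    "nat \<Rightarrow> nat \<Rightarrow> (nat \<times> nat) set \<Rightarrow> protocol \<Rightarrow> ((nat \<Rightarrow> bool list) \<Rightarrow> bool) \<Rightarrow> bool" where
  "computes k n E Q f \<longleftrightarrow>
     answerer Q \<in> {1..k} \<and>
     (\<forall>x\<in>inputs k (strings n).
        answer Q (restrict x (nbrs E (answerer Q))) (\<lambda>s p. sent k E Q x s p (answerer Q)) = f x)"

definition oblivious :: "nat \<Rightarrow> nat \<Rightarrow> (nat \<times> nat) set \<Rightarrow> protocol \<Rightarrow> bool" where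
  "oblivious k n E Q \<longleftrightarrow>
     (\<exists>L. \<forall>x\<in>inputs k (strings n). \<forall>t. \<forall>i\<in>{1..k}. \<forall>j\<in>{1..k}.
        length (sent k E Q x t i j) = L t i j)"

text \<open>The length map of an oblivious protocol; it is unique, since there is some input.\<close>

definition LEN :: "nat \<Rightarrow> nat \<Rightarrow> (nat \<times> nat) set \<Rightarrow> protocol \<Rightarrow> nat \<Rightarrow> nat \<Rightarrow> nat \<Rightarrow> nat" where
  "LEN k n E Q t i j =
     (THE m. \<forall>x\<in>inputs k (strings n). length (sent k E Q x t i j) = m)"

definition W :: "nat \<Rightarrow> nat \<Rightarrow> (nat \<times> nat) set \<Rightarrow> protocol \<Rightarrow> nat \<Rightarrow> nat \<Rightarrow> nat" where
  "W k n E Q a b = (\<Sum>t = 1..rounds Q. LEN k n E Q t a b)"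

definition D_NOF_G :: "nat \<Rightarrow> nat \<Rightarrow> (nat \<times> nat) set \<Rightarrow> protocol \<Rightarrow> nat" where
  "D_NOF_G k n E Q = (\<Sum>a = 1..k. \<Sum>b = 1..k. W k n E Q a b)"

definition pattern_robust ::
    "nat \<Rightarrow> nat \<Rightarrow> (nat \<times> nat) set \<Rightarrow> ((nat \<Rightarrow> bool list) \<Rightarrow> bool) \<Rightarrow> protocol \<Rightarrow> (nat \<Rightarrow> nat) \<Rightarrow> bool" where
  "pattern_robust k n E f Q \<pi> \<longleftrightarrow>
     (\<exists>Q'. oblivious k n (permuted_graph \<pi> E) Q' \<and>
           computes k n (permuted_graph \<pi> E) Q' f \<and>
           (\<forall>t. \<forall>i\<in>{1..k}. \<forall>j\<in>{1..k}.
              LEN k n (permuted_graph \<pi> E) Q' t i j = LEN k n E Q t (inv \<pi> i) (inv \<pi> j)))"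

definition MAP :: "(nat \<Rightarrow> nat \<Rightarrow> nat) \<Rightarrow> nat \<Rightarrow> nat set \<Rightarrow> nat set" where
  "MAP ps b R = (\<lambda>r. ps r b) ` R"

definition good_triple ::
    "nat \<Rightarrow> nat \<Rightarrow> (nat \<Rightarrow> nat \<Rightarrow> nat) \<Rightarrow> (nat \<times> nat) set \<Rightarrow> nat \<times> nat \<times> nat set \<Rightarrow> bool" where
  "good_triple k l ps E = (\<lambda>(a, b, R).
     a \<in> {1..k} \<and> b \<in> {1..k} \<and> a \<noteq> b \<and> R \<subseteq> {1..l} \<and>
     MAP ps a R = {a} \<and>
     MAP ps b R \<subseteq> non_nbrs k E a \<and> card (MAP ps b R) = card R \<and>
     a \<notin> MAP ps b R \<and> b \<notin> MAP ps b R \<and>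
     (\<forall>r\<in>R. (MAP ps b R \<union> {b}) - {ps r b} \<subseteq> non_nbrs k (permuted_graph (ps r) E) a))"

definition multiplexing_set ::
    "nat \<Rightarrow> nat \<Rightarrow> (nat \<Rightarrow> nat \<Rightarrow> nat) \<Rightarrow> (nat \<times> nat) set \<Rightarrow> (nat \<times> nat \<times> nat set) set \<Rightarrow> bool" where
  "multiplexing_set k l ps E S \<longleftrightarrow>
     (\<forall>T\<in>S. good_triple k l ps E T) \<and>
     (\<forall>(a, b, R)\<in>S. \<forall>(a', b', R')\<in>S. (a, b, R) \<noteq> (a', b', R') \<longrightarrow>
        a \<notin> {b'} \<union> MAP ps b' R' \<and>
        ({b} \<union> MAP ps b R) \<inter> ({b'} \<union> MAP ps b' R') = {})"

end

theory Submission
  imports Defs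
begin

text \<open>
  Run \<open>Q\<close> on instance \<open>1\<close> and its \<open>\<pi>\<^sub>r\<close>-pattern variant on instance \<open>r\<close>, all in parallel, with every
  message written on the board and the \<open>l\<close> answers announced at the end. For \<open>(a, b, R) \<in> S\<close>, the
  messages of one round from \<open>a\<close> to \<open>b\<close> in instance \<open>1\<close> and from \<open>a\<close> to \<open>\<pi>\<^sub>r(b)\<close> in the
  instances \<open>r \<in> R\<close> have the same length, and \<open>a\<close> writes only their bitwise exclusive or. Each
  receiver knows the other summands: they depend on inputs that are not on its forehead and on
  messages that \<open>a\<close> received, none of which is multiplexed.
\<close>

section \<open>Protocols from blocks of bits\<close>

text \<open>The length \<open>m\<close> is a parameter because the shape of the tree cannot depend
  on the input. The continuation \<open>K\<close> is applied to the word just written, which is how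
  later writers read the board.\<close>

primrec write_block ::
    "nat \<Rightarrow> nat \<Rightarrow> ((nat \<Rightarrow> 'x) \<Rightarrow> bool list) \<Rightarrow> (bool list \<Rightarrow> ('x, 'o) nof_protocol) \<Rightarrow> ('x, 'o) nof_protocol"
where
  "write_block i 0 h K = K []"
| "write_block i (Suc m) h K = Write i (\<lambda>v. hd (h v))
     (write_block i m (\<lambda>v. tl (h v)) (\<lambda>w. K (False # w)))
     (write_block i m (\<lambda>v. tl (h v)) (\<lambda>w. K (True # w)))"

lemma nof_wf_write_block:
  "i \<in> {1..k} \<Longrightarrow> (\<And>w. nof_wf k (K w)) \<Longrightarrow> nof_wf k (write_block i m h K)"
  by (induction m arbitrary: h K) auto

lemma nof_output_write_block:
  "length (h (nof_view k x i)) = m \<Longrightarrow>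
    nof_output k (write_block i m h K) x p = nof_output k (K (h (nof_view k x i))) x p"
proof (induction m arbitrary: h K)
  case (Suc m)
  then obtain b w where "h (nof_view k x i) = b # w" by (cases "h (nof_view k x i)") auto
  with Suc show ?case by (cases b) auto
qed auto

lemma nof_bits_write_block:
  "length (h (nof_view k x i)) = m \<Longrightarrow>
    nof_bits k (write_block i m h K) x = m + nof_bits k (K (h (nof_view k x i))) x"
proof (induction m arbitrary: h K)
  case (Suc m)
  then obtain b w where "h (nof_view k x i) = b # w" by (cases "h (nof_view k x i)") auto
  with Suc show ?case by (cases b) auto
qed auto

text \<open>A block of minimal \<open>rank\<close> depends on the view of its writer alone, so it
  can be written first. Induction then removes it from \<open>I\<close> and shrinks \<open>Y\<close>
  to the inputs that produce the word on the board. Knowledge is expressed by pairs of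
  indistinguishable inputs, so no decoder has to be built.\<close>

lemma nof_protocol_from_blocks:
  fixes val :: "'c \<Rightarrow> (nat \<Rightarrow> 'x) \<Rightarrow> bool list" and rank :: "'c \<Rightarrow> nat"
  assumes "finite I" and "\<And>c. c \<in> I \<Longrightarrow> writer c \<in> {1..k}"
    and "\<And>c x. c \<in> I \<Longrightarrow> x \<in> Y \<Longrightarrow> length (val c x) = len c"
    and "\<And>c x x'. c \<in> I \<Longrightarrow> x \<in> Y \<Longrightarrow> x' \<in> Y \<Longrightarrow>
      nof_view k x (writer c) = nof_view k x' (writer c) \<Longrightarrow>
      (\<And>d. d \<in> I \<Longrightarrow> rank d < rank c \<Longrightarrow> val d x = val d x') \<Longrightarrow> val c x = val c x'"
    and "\<And>x x'. x \<in> Y \<Longrightarrow> x' \<in> Y \<Longrightarrow> (\<And>d. d \<in> I \<Longrightarrow> val d x = val d x') \<Longrightarrow> g x = g x'"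
  shows "\<exists>P. nof_wf k P \<and>
    (\<forall>x\<in>Y. (\<forall>p. nof_output k P x p = g x) \<and> nof_bits k P x = (\<Sum>c\<in>I. len c))"
  using assms
proof (induction I arbitrary: Y rule: finite_psubset_induct)
  case (psubset I)
  show ?case
  proof (cases "I = {}")
    case True
    \<comment> \<open>With no blocks left, the premise of the last assumption about blocks is
      vacuous, so \<open>g\<close> is constant on \<open>Y\<close>.\<close>
    then have "\<forall>x\<in>Y. \<forall>x'\<in>Y. g x = g x'" using psubset.prems(4) by blast
    then obtain z where "\<forall>x\<in>Y. g x = z" by blast
    with True show ?thesis by (intro exI[of _ "Stop (\<lambda>_ _. z)"]) auto
  next
    case False
    define c where "c = arg_min_on rank I"
    have c: "c \<in> I" "\<And>d. d \<in> I \<Longrightarrow> \<not> rank d < rank c"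
      using arg_min_if_finite[OF psubset.hyps False, of rank] unfolding c_def by auto
    \<comment> \<open>The writer evaluates its block on an arbitrary input in \<open>Y\<close>
      compatible with its view; all of them give the same word, as no block has lower rank than
      \<open>c\<close>.\<close>
    define h where
      "h v = val c (SOME x. x \<in> Y \<and> nof_view k x (writer c) = v)" for v
    have h: "h (nof_view k x (writer c)) = val c x" if "x \<in> Y" for x
    proof -
      let ?x = "SOME x'. x' \<in> Y \<and> nof_view k x' (writer c) = nof_view k x (writer c)"
      have x: "?x \<in> Y \<and> nof_view k ?x (writer c) = nof_view k x (writer c)"
        by (rule someI[of _ x]) (use that in simp)
      show ?thesis
        unfolding h_def by (rule psubset.prems(3)) (use x c that in auto)
    qed
    have "\<exists>P. nof_wf k P \<and> (\<forall>x\<in>{x \<in> Y. val c x = w}.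
        (\<forall>p. nof_output k P x p = g x) \<and> nof_bits k P x = (\<Sum>c\<in>I - {c}. len c))" for w
    proof (rule psubset.IH)
      show "I - {c} \<subset> I" using c by blast
    next
      fix d x x'
      assume d: "d \<in> I - {c}" "x \<in> {x \<in> Y. val c x = w}" "x' \<in> {x \<in> Y. val c x = w}"
        "nof_view k x (writer d) = nof_view k x' (writer d)"
        "\<And>e. e \<in> I - {c} \<Longrightarrow> rank e < rank d \<Longrightarrow> val e x = val e x'"
      \<comment> \<open>On the branch \<open>w\<close> both inputs give block \<open>c\<close> the
        value \<open>w\<close>, so the removed block still counts as known.\<close>
      have "val e x = val e x'" if "e \<in> I" "rank e < rank d" for e
        using d that by (cases "e = c") auto
      then show "val d x = val d x'" by (rule psubset.prems(3)[rotated 4]) (use d in auto)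
    next
      fix x x'
      assume x: "x \<in> {x \<in> Y. val c x = w}" "x' \<in> {x \<in> Y. val c x = w}"
        "\<And>d. d \<in> I - {c} \<Longrightarrow> val d x = val d x'"
      have "val d x = val d x'" if "d \<in> I" for d
        using x that by (cases "d = c") auto
      then show "g x = g x'" by (rule psubset.prems(4)[rotated 2]) (use x in auto)
    qed (use psubset.prems(1,2) in auto)
    then have "\<exists>K. \<forall>w. nof_wf k (K w) \<and> (\<forall>x\<in>{x \<in> Y. val c x = w}.
        (\<forall>p. nof_output k (K w) x p = g x) \<and> nof_bits k (K w) x = (\<Sum>c\<in>I - {c}. len c))"
      by (intro choice allI)
    then obtain K where K: "\<And>w. nof_wf k (K w) \<and> (\<forall>x\<in>{x \<in> Y. val c x = w}.
        (\<forall>p. nof_output k (K w) x p = g x) \<and> nof_bits k (K w) x = (\<Sum>c\<in>I - {c}. len c))"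
      by blast
    let ?P = "write_block (writer c) (len c) h K"
    have "(\<Sum>c\<in>I. len c) = len c + (\<Sum>c\<in>I - {c}. len c)"
      using c psubset.hyps by (simp add: sum.remove)
    moreover have "nof_output k ?P x p = g x"
      "nof_bits k ?P x = len c + (\<Sum>c\<in>I - {c}. len c)" if "x \<in> Y" for x p
    proof -
      have "length (h (nof_view k x (writer c))) = len c"
        using h psubset.prems(2) c that by simp
      then show "nof_output k ?P x p = g x" "nof_bits k ?P x = len c + (\<Sum>c\<in>I - {c}. len c)"
        using K[of "val c x"] h that by (simp_all add: nof_output_write_block nof_bits_write_block)
    qed
    moreover have "nof_wf k ?P" using nof_wf_write_block psubset.prems(1) c K by blast
    ultimately show ?thesis by metis
  qed
qed

lemma D_NOF_le:
  assumes "nof_computes k X P g" and "\<And>x. x \<in> inputs k X \<Longrightarrow> nof_bits k P x \<le> m"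
  shows "D_NOF k X g \<le> enat m"
  unfolding D_NOF_def using assms by (intro INF_lower2[of P] SUP_least) auto

section \<open>Bitwise exclusive or\<close>

definition xor_block :: "nat \<Rightarrow> ('c \<Rightarrow> bool list) \<Rightarrow> 'c set \<Rightarrow> bool list" where
  "xor_block m w C = map (\<lambda>q. odd (card {c \<in> C. w c ! q})) [0..<m]"

lemma length_xor_block [simp]: "length (xor_block m w C) = m"
  by (simp add: xor_block_def)

lemma xor_block_cong: "(\<And>c. c \<in> C \<Longrightarrow> w c = w' c) \<Longrightarrow> xor_block m w C = xor_block m w' C"
proof -
  assume "\<And>c. c \<in> C \<Longrightarrow> w c = w' c"
  then have "{c \<in> C. w c ! q} = {c \<in> C. w' c ! q}" for q by auto
  then show ?thesis by (simp add: xor_block_def)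
qed

text \<open>At each position the parity is the bit of \<open>c\<close> plus the parity over the
  other words, and those agree by assumption.\<close>

lemma xor_block_cancel:
  assumes "xor_block m w C = xor_block m w' C" and "finite C" and "c \<in> C"
    and "length (w c) = m" and "length (w' c) = m"
    and eq: "\<And>d. d \<in> C \<Longrightarrow> d \<noteq> c \<Longrightarrow> w d = w' d"
  shows "w c = w' c"
proof (rule nth_equalityI)
  fix q assume "q < length (w c)"
  then have q: "odd (card {d \<in> C. w d ! q}) \<longleftrightarrow> odd (card {d \<in> C. w' d ! q})"
    using assms(1,4) unfolding xor_block_def by auto
  have split: "card {d \<in> C. u d ! q} = (if u c ! q then 1 else 0) + card {d \<in> C - {c}. u d ! q}"
    for u :: "'a \<Rightarrow> bool list"
  proof (cases "u c ! q")
    case True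
    then have "{d \<in> C. u d ! q} = insert c {d \<in> C - {c}. u d ! q}" using assms(3) by auto
    with True assms(2) show ?thesis by simp
  next
    case False
    then have "{d \<in> C. u d ! q} = {d \<in> C - {c}. u d ! q}" by auto
    with False show ?thesis by simp
  qed
  have "{d \<in> C - {c}. w d ! q} = {d \<in> C - {c}. w' d ! q}" using eq by auto
  with q show "w c ! q = w' c ! q" by (auto simp: split split: if_splits)
qed (use assms in simp)

section \<open>Oblivious protocols\<close>

lemma inputs_strings_nonempty: "inputs k (strings n) \<noteq> {}"
proof -
  have "replicate n False \<in> strings n" by (simp add: strings_def)
  then show ?thesis by (auto simp: inputs_def PiE_eq_empty_iff)
qed

lemma length_sent_LEN:
  assumes "oblivious k n E Q" "x \<in> inputs k (strings n)" "i \<in> {1..k}" "j \<in> {1..k}"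
  shows "length (sent k E Q x t i j) = LEN k n E Q t i j"
proof -
  obtain L where L: "\<forall>x\<in>inputs k (strings n). length (sent k E Q x t i j) = L"
    using assms unfolding oblivious_def by blast
  have "\<forall>x\<in>inputs k (strings n). length (sent k E Q x t i j) = LEN k n E Q t i j"
    unfolding LEN_def by (rule theI, rule L) (metis L assms(2))
  with assms(2) show ?thesis by blast
qed

lemma sent_eq_Nil:
  "\<not> (t \<in> {1..rounds Q} \<and> i \<in> {1..k} \<and> j \<in> {1..k}) \<Longrightarrow> sent k E Q x t i j = []"
  by (subst sent.simps) auto

text \<open>Rounds beyond \<open>rounds Q\<close> carry only empty messages, so protocols with
  different numbers of rounds can share one horizon \<open>T\<close>.\<close>

lemma W_eq_sum:
  assumes "oblivious k n E Q" "rounds Q \<le> T" "i \<in> {1..k}" "j \<in> {1..k}"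
  shows "W k n E Q i j = (\<Sum>t = 1..T. LEN k n E Q t i j)"
proof -
  obtain x where "x \<in> inputs k (strings n)" using inputs_strings_nonempty by blast
  then have "LEN k n E Q t i j = 0" if "t \<notin> {1..rounds Q}" for t
    using length_sent_LEN[OF assms(1) _ assms(3,4), of x t] sent_eq_Nil that by auto
  then show ?thesis unfolding W_def using assms(2) by (intro sum.mono_neutral_left) auto
qed

lemma sent_cong:
  assumes "restrict x (nbrs E i) = restrict x' (nbrs E i)"
    and "\<And>s p. s < t \<Longrightarrow> sent k E Q x s p i = sent k E Q x' s p i"
  shows "sent k E Q x t i j = sent k E Q x' t i j"
proof -
  have "(\<lambda>s p. if s < t then sent k E Q x s p i else []) =
      (\<lambda>s p. if s < t then sent k E Q x' s p i else [])"
    using assms(2) by (intro ext) auto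
  with assms(1) show ?thesis
    by (simp only: sent.simps[of k E Q x t i j] sent.simps[of k E Q x' t i j])
qed

lemma restriction_graph_permuted:
  assumes "restriction_graph k E" "\<pi> permutes {1..k}"
  shows "restriction_graph k (permuted_graph \<pi> E)"
  using assms(1) permutes_in_image[OF assms(2)] inj_eq[OF permutes_inj[OF assms(2)]]
  by (auto simp: restriction_graph_def permuted_graph_def irrefl_def)

section \<open>Multiplexed simulation\<close>

definition instance_input :: "nat \<Rightarrow> (nat \<Rightarrow> nat \<Rightarrow> 'x) \<Rightarrow> nat \<Rightarrow> nat \<Rightarrow> 'x" where
  "instance_input k y r = (\<lambda>j\<in>{1..k}. y j r)"

lemma instance_input_in_inputs:
  "y \<in> inputs k (multi_strings l n) \<Longrightarrow> r \<in> {1..l} \<Longrightarrow> instance_input k y r \<in> inputs k (strings n)"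
  by (auto simp: instance_input_def inputs_def multi_strings_def PiE_iff)

text \<open>The only coordinate missing from the view of \<open>p\<close> is \<open>p\<close>
  itself. With \<open>A\<close> the neighbours of a party that does not see coordinate
  \<open>p\<close>, this lets \<open>p\<close> compute what that party sees.\<close>

lemma restrict_instance_input_eq:
  assumes "nof_view k y p = nof_view k y' p" "p \<notin> A"
  shows "restrict (instance_input k y r) A = restrict (instance_input k y' r) A"
proof
  fix j
  show "restrict (instance_input k y r) A j = restrict (instance_input k y' r) A j"
    using fun_cong[OF assms(1), of j] assms(2)
    by (auto simp: nof_view_def instance_input_def restrict_def split: if_splits)
qed

text \<open>
  A channel \<open>(r, i, j)\<close> carries the messages from \<open>i\<close> to \<open>j\<close> in instance \<open>r\<close>. In each round the
  channels of a class \<open>cls c\<close> share one block, whose length is \<open>len\<close>.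
\<close>

lemma D_NOF_multi_le:
  fixes G :: "nat \<Rightarrow> (nat \<times> nat) set" and Qs :: "nat \<Rightarrow> protocol"
    and cls :: "'c \<Rightarrow> (nat \<times> nat \<times> nat) set"
  assumes graph: "\<And>r. r \<in> {1..l} \<Longrightarrow> restriction_graph k (G r)"
    and comp: "\<And>r. r \<in> {1..l} \<Longrightarrow> computes k n (G r) (Qs r) f"
    and obl: "\<And>r. r \<in> {1..l} \<Longrightarrow> oblivious k n (G r) (Qs r)"
    and rounds: "\<And>r. r \<in> {1..l} \<Longrightarrow> rounds (Qs r) \<le> T"
    and J: "finite J"
    and cls: "\<And>c. c \<in> J \<Longrightarrow> cls c \<subseteq> {1..l} \<times> {1..k} \<times> {1..k}"
    and writer: "\<And>c. c \<in> J \<Longrightarrow> writer c \<in> {1..k}"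
    and sender: "\<And>c r i j. c \<in> J \<Longrightarrow> (r, i, j) \<in> cls c \<Longrightarrow> i = writer c"
    and cover: "\<And>r i j. r \<in> {1..l} \<Longrightarrow> i \<in> {1..k} \<Longrightarrow> j \<in> {1..k} \<Longrightarrow> \<exists>c\<in>J. (r, i, j) \<in> cls c"
    and len: "\<And>c r i j t. c \<in> J \<Longrightarrow> (r, i, j) \<in> cls c \<Longrightarrow> LEN k n (G r) (Qs r) t i j = len t c"
    and hidden: "\<And>c r i j r' j'. c \<in> J \<Longrightarrow> (r, i, j) \<in> cls c \<Longrightarrow> (r', i, j') \<in> cls c \<Longrightarrow>
      (r, i, j) \<noteq> (r', i, j') \<Longrightarrow> j \<notin> nbrs (G r') i"
    and clear: "\<And>c r i j r' j' s p. c \<in> J \<Longrightarrow> (r, i, j) \<in> cls c \<Longrightarrow> (r', i, j') \<in> cls c \<Longrightarrow>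
      (r, i, j) \<noteq> (r', i, j') \<Longrightarrow> s \<in> {1..l} \<Longrightarrow> p \<in> {1..k} \<Longrightarrow> \<exists>d\<in>J. cls d = {(s, p, i)}"
  shows "D_NOF k (multi_strings l n) (multi k l f) \<le> enat ((\<Sum>t = 1..T. \<Sum>c\<in>J. len t c) + l)"
proof -
  let ?Y = "inputs k (multi_strings l n)"
  define M where
    "M y t = (\<lambda>(r, i, j). sent k (G r) (Qs r) (instance_input k y r) t i j)" for y t
  \<comment> \<open>One block per round and class, then one answer bit per instance;
    \<open>rank\<close> is the round, and \<open>Suc T\<close> places the answers after all
    rounds.\<close>
  define I where "I = ({1..T} \<times> J) <+> {1..l}"
  define val where "val = case_sum (\<lambda>(t, c) y. xor_block (len t c) (M y t) (cls c))
    (\<lambda>r y. [f (instance_input k y r)])"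
  define wr :: "nat \<times> 'c + nat \<Rightarrow> nat" where
    "wr = case_sum (\<lambda>(t, c). writer c) (\<lambda>r. answerer (Qs r))"
  define rank :: "nat \<times> 'c + nat \<Rightarrow> nat" where
    "rank = case_sum (\<lambda>(t, c). t) (\<lambda>r. Suc T)"
  define ln :: "nat \<times> 'c + nat \<Rightarrow> nat" where
    "ln = case_sum (\<lambda>(t, c). len t c) (\<lambda>r. 1)"
  have I_iff: "Inl (t, c) \<in> I \<longleftrightarrow> t \<in> {1..T} \<and> c \<in> J" "Inr r \<in> I \<longleftrightarrow> r \<in> {1..l}" for t c r
    by (auto simp: I_def)
  have len_M: "length (M y t (r, i, j)) = LEN k n (G r) (Qs r) t i j"
    if "y \<in> ?Y" "r \<in> {1..l}" "i \<in> {1..k}" "j \<in> {1..k}" for y t r i j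
    using that length_sent_LEN[OF obl instance_input_in_inputs] by (simp add: M_def)
  \<comment> \<open>Histories range over all rounds and senders; off the actual ones the message is
    empty on every input.\<close>
  have M_idle: "M y t (r, i, j) = M y' t (r, i, j)"
    if "\<not> (t \<in> {1..T} \<and> i \<in> {1..k} \<and> j \<in> {1..k})" "r \<in> {1..l}" for y y' t r i j
  proof -
    have "M z t (r, i, j) = []" for z
      using that rounds[of r] unfolding M_def prod.case by (intro sent_eq_Nil) auto
    then show ?thesis by simp
  qed
  \<comment> \<open>Here \<open>p\<close> need not be the sender \<open>i\<close>: any party whose
    forehead \<open>i\<close> does not see in instance \<open>r\<close> can reproduce the messages
    of \<open>i\<close> from what \<open>i\<close> has received.\<close>
  have M_cong: "M y t (r, i, j) = M y' t (r, i, j)"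
    if "nof_view k y p = nof_view k y' p" "p \<notin> nbrs (G r) i"
      "\<And>s q. s < t \<Longrightarrow> M y s (r, q, i) = M y' s (r, q, i)"
    for y y' p t r i j
    unfolding M_def prod.case
    by (rule sent_cong[OF restrict_instance_input_eq[OF that(1,2)]])
      (use that(3) in \<open>simp add: M_def\<close>)
  have blocks_eq: "xor_block (len t c) (M y t) (cls c) = xor_block (len t c) (M y' t) (cls c)"
    if "\<And>d. d \<in> I \<Longrightarrow> rank d < m \<Longrightarrow> val d y = val d y'" "t \<in> {1..T}" "t < m" "c \<in> J"
    for y y' m t c
    using that(1)[of "Inl (t, c)"] that(2-) by (simp add: I_iff rank_def val_def)
  \<comment> \<open>In a class with a single channel the block determines the message, there being
    nothing to cancel.\<close>
  have clear_eq: "M y t (r, p, i) = M y' t (r, p, i)"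
    if y: "y \<in> ?Y" "y' \<in> ?Y"
      and I: "\<And>d. d \<in> I \<Longrightarrow> rank d < m \<Longrightarrow> val d y = val d y'" and "t < m"
      and d: "d \<in> J" "cls d = {(r, p, i)}" for y y' m t r p i d
  proof (cases "t \<in> {1..T}")
    case True
    have "r \<in> {1..l}" "p \<in> {1..k}" "i \<in> {1..k}" using cls[OF d(1)] d(2) by auto
    then have len_d: "length (M z t (r, p, i)) = len t d" if "z \<in> ?Y" for z
      using len_M[OF that] len[OF d(1), of r p i t] d(2) by simp
    show ?thesis
      by (rule xor_block_cancel[OF blocks_eq[OF I True \<open>t < m\<close> d(1)]])
        (simp_all add: d(2) y len_d)
  next
    case False
    moreover have "r \<in> {1..l}" using cls[OF d(1)] d(2) by simp
    ultimately show ?thesis by (blast intro: M_idle)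
  qed
  \<comment> \<open>Decoding at the receiver \<open>p\<close>: every other message in the block
    comes from the same \<open>i\<close>, is independent of the forehead of \<open>p\<close> by
    \<open>hidden\<close>, and rests on messages to \<open>i\<close> that are readable from the
    board by \<open>clear\<close>. So only the message to \<open>p\<close> is left in the exclusive
    or.\<close>
  have inbox_eq: "M y t (r, i, p) = M y' t (r, i, p)"
    if y: "y \<in> ?Y" "y' \<in> ?Y"
      and I: "\<And>d. d \<in> I \<Longrightarrow> rank d < m \<Longrightarrow> val d y = val d y'" and "t < m"
      and view: "nof_view k y p = nof_view k y' p" and r: "r \<in> {1..l}" for y y' m t r i p
  proof (cases "t \<in> {1..T} \<and> i \<in> {1..k} \<and> p \<in> {1..k}")
    case True
    then obtain c where c: "c \<in> J" "(r, i, p) \<in> cls c" using cover r by blast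
    have others: "M y t d = M y' t d" if d: "d \<in> cls c" "d \<noteq> (r, i, p)" for d
    proof -
      obtain r' j' where d': "d = (r', i, j')"
        using sender[OF c(1)] c(2) d(1) by (metis prod_cases3)
      have r': "r' \<in> {1..l}" using cls[OF c(1)] d(1) d' by auto
      have inbox: "M y s (r', q, i) = M y' s (r', q, i)" if "s < t" for s q
      proof (cases "q \<in> {1..k}")
        case True
        then obtain e where "e \<in> J" "cls e = {(r', q, i)}"
          using clear[OF c(1,2), of r' j' r' q] d d' r' by auto
        moreover have "s < m" using that \<open>t < m\<close> by simp
        ultimately show ?thesis using clear_eq[OF y I] by blast
      next
        case False
        then show ?thesis using r' by (blast intro: M_idle)
      qed
      have "p \<notin> nbrs (G r') i" using hidden[OF c, of r' j'] d d' by auto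
      then show ?thesis unfolding d' by (rule M_cong[OF view _ inbox])
    qed
    have len_c: "length (M z t (r, i, p)) = len t c" if "z \<in> ?Y" for z
      using len_M[OF that] len[OF c] True r by simp
    have block: "xor_block (len t c) (M y t) (cls c) = xor_block (len t c) (M y' t) (cls c)"
      using blocks_eq[OF I] True \<open>t < m\<close> c by blast
    show ?thesis
    proof (rule xor_block_cancel[OF block _ c(2) len_c[OF y(1)] len_c[OF y(2)] others])
      show "finite (cls c)" by (rule finite_subset[OF cls[OF c(1)]]) auto
    qed
  next
    case False
    then show ?thesis using r by (blast intro: M_idle)
  qed
  have no_loop: "p \<notin> nbrs (G r) p" if "r \<in> {1..l}" for r p
    using graph[OF that] by (auto simp: restriction_graph_def irrefl_def nbrs_def)
  \<comment> \<open>Now \<open>p\<close> is the sender: without loops it never uses its own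
    forehead, and it has decoded all it received before round \<open>t\<close>.\<close>
  have sent_eq: "M y t (r, p, j) = M y' t (r, p, j)"
    if "y \<in> ?Y" "y' \<in> ?Y"
      "\<And>d. d \<in> I \<Longrightarrow> rank d < t \<Longrightarrow> val d y = val d y'"
      "nof_view k y p = nof_view k y' p" "r \<in> {1..l}" for y y' t r p j
    by (rule M_cong[OF that(4) no_loop[OF that(5)] inbox_eq[OF that(1-3) _ that(4,5)]])
  \<comment> \<open>The answer rests on the complete history, hence the bound \<open>Suc T\<close>,
    which covers the blocks of every round.\<close>
  have answer_eq: "f (instance_input k y r) = f (instance_input k y' r)"
    if y: "y \<in> ?Y" "y' \<in> ?Y"
      and I: "\<And>d. d \<in> I \<Longrightarrow> rank d < Suc T \<Longrightarrow> val d y = val d y'"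
      and view: "nof_view k y (answerer (Qs r)) = nof_view k y' (answerer (Qs r))"
      and r: "r \<in> {1..l}" for y y' r
  proof -
    let ?p = "answerer (Qs r)"
    have f: "f (instance_input k z r) =
      answer (Qs r) (restrict (instance_input k z r) (nbrs (G r) ?p)) (\<lambda>s q. M z s (r, q, ?p))"
      if "z \<in> ?Y" for z
      using comp[OF r] instance_input_in_inputs[OF that r] by (auto simp: computes_def M_def)
    have "M y s (r, q, ?p) = M y' s (r, q, ?p)" for s q
    proof (cases "s < Suc T")
      case True
      then show ?thesis using inbox_eq[OF y I] view r by blast
    next
      case False
      then have "s \<notin> {1..T}" by simp
      then show ?thesis using r by (blast intro: M_idle)
    qed
    then show ?thesis
      using f y restrict_instance_input_eq[OF view no_loop[OF r], of r] by presburger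
  qed
  have "\<exists>P. nof_wf k P \<and> (\<forall>y\<in>?Y. (\<forall>p. nof_output k P y p = multi k l f y) \<and>
      nof_bits k P y = (\<Sum>c\<in>I. ln c))"
  proof (rule nof_protocol_from_blocks)
    show "finite I" using J by (simp add: I_def)
    show "wr c \<in> {1..k}" if "c \<in> I" for c
      using that writer comp by (auto simp: I_def wr_def computes_def)
    show "length (val c y) = ln c" for c y
      by (auto simp: val_def ln_def split: sum.split)
    show "val c y = val c y'"
      if c: "c \<in> I" and y: "y \<in> ?Y" "y' \<in> ?Y" and view: "nof_view k y (wr c) = nof_view k y' (wr c)"
        and less: "\<And>d. d \<in> I \<Longrightarrow> rank d < rank c \<Longrightarrow> val d y = val d y'" for c y y'
    proof (cases c)
      case (Inl tb)
      then obtain t b where b: "c = Inl (t, b)" "t \<in> {1..T}" "b \<in> J"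
        using c by (cases tb) (auto simp: I_iff)
      have "xor_block (len t b) (M y t) (cls b) = xor_block (len t b) (M y' t) (cls b)"
      proof (rule xor_block_cong)
        fix e assume e: "e \<in> cls b"
        then obtain r j where "e = (r, writer b, j)" "r \<in> {1..l}"
          using sender[OF b(3)] cls[OF b(3)] by (cases e) auto
        moreover have "val d y = val d y'" if "d \<in> I" "rank d < t" for d
          using less that b(1) by (simp add: rank_def)
        moreover have "nof_view k y (writer b) = nof_view k y' (writer b)"
          using view b(1) by (simp add: wr_def)
        ultimately show "M y t e = M y' t e" using sent_eq[OF y] by blast
      qed
      with b show ?thesis by (simp add: val_def)
    next
      case (Inr r)
      then have "f (instance_input k y r) = f (instance_input k y' r)"
        using less view c by (intro answer_eq[OF y]) (simp_all add: wr_def rank_def I_iff)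
      with Inr show ?thesis by (simp add: val_def)
    qed
    show "multi k l f y = multi k l f y'"
      if "\<And>d. d \<in> I \<Longrightarrow> val d y = val d y'" for y y'
    proof -
      have "f (instance_input k y r) = f (instance_input k y' r)" if "r \<in> {1..l}" for r
        using that \<open>\<And>d. d \<in> I \<Longrightarrow> val d y = val d y'\<close>[of "Inr r"] by (simp add: I_iff val_def)
      then show ?thesis by (auto simp: multi_def instance_input_def restrict_def)
    qed
  qed
  moreover have "(\<Sum>c\<in>I. ln c) = (\<Sum>t = 1..T. \<Sum>c\<in>J. len t c) + l"
    unfolding I_def ln_def using J by (simp add: sum.Plus sum.cartesian_product)
  ultimately show ?thesis
    by (elim exE conjE) (rule D_NOF_le, auto simp: nof_computes_def)
qed

section \<open>Channels multiplexed by a good triple\<close>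

definition mux_channels ::
    "(nat \<Rightarrow> nat \<Rightarrow> nat) \<Rightarrow> nat \<times> nat \<times> nat set \<Rightarrow> (nat \<times> nat \<times> nat) set" where
  "mux_channels ps = (\<lambda>(a, b, R). insert (1, a, b) ((\<lambda>r. (r, a, ps r b)) ` R))"

lemma good_tripleD:
  assumes "good_triple k l ps E (a, b, R)"
  shows "a \<in> {1..k}" "b \<in> {1..k}" "a \<noteq> b" "R \<subseteq> {1..l}" "\<And>r. r \<in> R \<Longrightarrow> ps r a = a"
    "MAP ps b R \<subseteq> non_nbrs k E a" "card (MAP ps b R) = card R" "a \<notin> MAP ps b R" "b \<notin> MAP ps b R"
    "\<And>r. r \<in> R \<Longrightarrow> MAP ps b R \<union> {b} - {ps r b} \<subseteq> non_nbrs k (permuted_graph (ps r) E) a"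
proof -
  have "MAP ps a R = {a}" using assms unfolding good_triple_def prod.case by blast
  then show "ps r a = a" if "r \<in> R" for r using that unfolding MAP_def by blast
qed (use assms in \<open>unfold good_triple_def prod.case, blast+\<close>)

text \<open>The size condition on \<open>MAP ps b R\<close> makes \<open>\<lambda>r. ps r b\<close>
  injective on the finite set \<open>R\<close>.\<close>

lemma good_triple_inj:
  assumes "good_triple k l ps E (a, b, R)" "r \<in> R" "s \<in> R" "ps r b = ps s b"
  shows "r = s"
proof -
  have "finite R" "card ((\<lambda>r. ps r b) ` R) = card R"
    using good_tripleD(4,7)[OF assms(1)] by (auto simp: MAP_def dest: finite_subset)
  then show ?thesis using assms(2-) by (meson eq_card_imp_inj_on inj_onD)
qed

text \<open>As \<open>ps 1\<close> is the identity, \<open>1 \<in> R\<close> would put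
  \<open>b\<close> itself into \<open>MAP ps b R\<close>.\<close>

lemma one_notin_good_triple:
  assumes "good_triple k l ps E (a, b, R)" "ps 1 = id"
  shows "1 \<notin> R"
proof
  assume "1 \<in> R"
  then have "ps 1 b \<in> MAP ps b R" unfolding MAP_def by (rule imageI)
  then show False using good_tripleD(9)[OF assms(1)] assms(2) by simp
qed

text \<open>The channel of instance 1 is counted besides those of \<open>R\<close>, so one block for
  all of them saves exactly \<open>card R\<close> messages.\<close>

lemma card_mux_channels:
  assumes "good_triple k l ps E (a, b, R)" "ps 1 = id"
  shows "card (mux_channels ps (a, b, R)) = Suc (card R)"
proof -
  have "finite R" using good_tripleD(4)[OF assms(1)] by (auto dest: finite_subset)
  moreover have "(1, a, b) \<notin> (\<lambda>r. (r, a, ps r b)) ` R"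
    using one_notin_good_triple[OF assms] by auto
  moreover have "inj_on (\<lambda>r. (r, a, ps r b)) R" by (auto simp: inj_on_def)
  ultimately show ?thesis
    by (simp only: mux_channels_def prod.case card_insert_disjoint finite_imageI card_image
        not_False_eq_True)
qed

theorem theorem1:
  fixes k n l :: nat
    and f :: "(nat \<Rightarrow> bool list) \<Rightarrow> bool"
    and E :: "(nat \<times> nat) set"
    and Q :: protocol
    and ps :: "nat \<Rightarrow> nat \<Rightarrow> nat"
    and S :: "(nat \<times> nat \<times> nat set) set"
  assumes "restriction_graph k E"
    and "oblivious k n E Q"
    and "computes k n E Q f"
    and "1 \<le> l"
    and "\<forall>i\<in>{1..l}. ps i permutes {1..k}"
    and "ps 1 = id"
    and "\<forall>i\<in>{2..l}. pattern_robust k n E f Q (ps i)"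
    and "multiplexing_set k l ps E S"
  shows "ereal_of_enat (D_NOF k (multi_strings l n) (multi k l f))
    \<le> ereal (real l * real (D_NOF_G k n E Q) + real l
        - (\<Sum>(a, b, R)\<in>S. real (card R) * real (W k n E Q a b)))"
proof -

  \<comment> \<open>Pattern-robust variants for the instances\<close>
  define G where "G r = permuted_graph (ps r) E" for r
  \<comment> \<open>\<open>inv (ps r)\<close> carries a channel of instance \<open>r\<close> back to
    the channel of \<open>Q\<close> with the same message lengths.\<close>
  define L where "L t r i j = LEN k n E Q t (inv (ps r) i) (inv (ps r) j)" for t r i j
  have G1: "G 1 = E" using assms(6) by (auto simp: G_def permuted_graph_def)
  have "\<exists>Q'. oblivious k n (G r) Q' \<and> computes k n (G r) Q' f \<and>
      (\<forall>t. \<forall>i\<in>{1..k}. \<forall>j\<in>{1..k}. LEN k n (G r) Q' t i j = L t r i j)" if "r \<in> {1..l}" for r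
  proof (cases "r = 1")
    case True
    then show ?thesis using assms(2,3,6) G1 by (intro exI[of _ Q]) (auto simp: L_def)
  next
    case False
    then have "r \<in> {2..l}" using that by auto
    then show ?thesis using assms(7) unfolding pattern_robust_def G_def L_def by blast
  qed
  then obtain Qs where Qs: "\<And>r. r \<in> {1..l} \<Longrightarrow> oblivious k n (G r) (Qs r)"
    "\<And>r. r \<in> {1..l} \<Longrightarrow> computes k n (G r) (Qs r) f"
    "\<And>r t i j. r \<in> {1..l} \<Longrightarrow> i \<in> {1..k} \<Longrightarrow> j \<in> {1..k} \<Longrightarrow>
      LEN k n (G r) (Qs r) t i j = L t r i j"
    by metis
  \<comment> \<open>One horizon for all instances; \<open>rounds Q\<close> is included so that
    \<open>W\<close> can be summed over the same rounds.\<close>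
  have "\<exists>T. \<forall>m\<in>insert (rounds Q) ((\<lambda>r. rounds (Qs r)) ` {1..l}). m \<le> T"
    by (subst finite_nat_set_iff_bounded_le[symmetric]) simp
  then obtain T where T: "rounds Q \<le> T" "\<And>r. r \<in> {1..l} \<Longrightarrow> rounds (Qs r) \<le> T" by auto

  \<comment> \<open>Channel classes from the multiplexing set\<close>
  define mux where "mux = mux_channels ps"
  define chan where "chan = {1..l} \<times> {1..k} \<times> {1..k}"
  \<comment> \<open>Every triple forms one class, and each remaining channel a class of its
    own.\<close>
  define J where "J = (chan - \<Union> (mux ` S)) <+> S"
  define cls where "cls = case_sum (\<lambda>c. {c}) mux"
  define writer where
    "writer = case_sum (\<lambda>(r :: nat, i :: nat, j :: nat). i) (\<lambda>(a, b :: nat, R :: nat set). a)"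
  define len where
    "len t = case_sum (\<lambda>(r, i, j). L t r i j) (\<lambda>(a, b, R :: nat set). LEN k n E Q t a b)" for t

  have good: "good_triple k l ps E (a, b, R)" if "(a, b, R) \<in> S" for a b R
    using assms(8) that by (auto simp: multiplexing_set_def)
  have perm: "ps r permutes {1..k}" if "r \<in> {1..l}" for r using assms(5) that by blast
  \<comment> \<open>Over an infinite \<open>S\<close> the sums would be 0 by convention; but good
    triples lie in a finite product.\<close>
  have S_fin: "finite S"
  proof (rule finite_subset)
    show "S \<subseteq> {1..k} \<times> {1..k} \<times> Pow {1..l}"
    proof
      fix X assume "X \<in> S"
      moreover obtain a b R where "X = (a, b, R)" by (rule prod_cases3)
      ultimately show "X \<in> {1..k} \<times> {1..k} \<times> Pow {1..l}"
        using good_tripleD(1,2,4)[OF good] by (simp only: mem_Sigma_iff Pow_iff)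
    qed
  qed auto
  have mux_E: "thesis"
    if "(a, b, R) \<in> S" "(r, i, j) \<in> mux (a, b, R)"
      "r = 1 \<Longrightarrow> i = a \<Longrightarrow> j = b \<Longrightarrow> thesis"
      "r \<in> R \<Longrightarrow> r \<noteq> 1 \<Longrightarrow> i = a \<Longrightarrow> j = ps r b \<Longrightarrow> thesis" for a b R r i j thesis
    using that one_notin_good_triple[OF good[OF that(1)] assms(6)]
    by (auto simp: mux_def mux_channels_def)
  have mux_chan: "mux (a, b, R) \<subseteq> chan" if "(a, b, R) \<in> S" for a b R
  proof -
    have "ps r b \<in> {1..k}" if "r \<in> R" for r
      using good_tripleD(2,4)[OF good[OF \<open>(a, b, R) \<in> S\<close>]] that permutes_in_image[OF perm, of r b]
      by blast
    then show ?thesis using good_tripleD(1,2,4)[OF good[OF that]] assms(4)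
      by (auto simp: mux_def mux_channels_def chan_def)
  qed
  then have mux_sub: "\<Union> (mux ` S) \<subseteq> chan" by (metis UN_least prod_cases3)
  \<comment> \<open>Since \<open>ps r\<close> fixes \<open>a\<close>, its inverse takes
    \<open>(a, ps r b)\<close> to \<open>(a, b)\<close>. Hence all messages of a class have equal
    length in each round.\<close>
  have L_mux: "L t r i j = LEN k n E Q t a b"
    if "(a, b, R) \<in> S" "(r, i, j) \<in> mux (a, b, R)" for t r i j a b R
    using that
  proof (rule mux_E)
    assume r: "r \<in> R" "i = a" "j = ps r b"
    with good_tripleD(4,5)[OF good[OF that(1)]] have "ps r a = a" "r \<in> {1..l}" by auto
    then have "inv (ps r) a = a" "inv (ps r) (ps r b) = b"
      using permutes_inj[OF perm, of r] by (metis inv_f_f)+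
    with r show ?thesis by (simp add: L_def)
  qed (use assms(6) in \<open>simp add: L_def\<close>)
  have receiver: "j \<in> {b} \<union> MAP ps b R"
    if "(a, b, R) \<in> S" "(r, i, j) \<in> mux (a, b, R)" for a b R r i j
    using that by (auto simp: mux_def mux_channels_def MAP_def)
  have separate: "a \<notin> {b'} \<union> MAP ps b' R'"
      "({b} \<union> MAP ps b R) \<inter> ({b'} \<union> MAP ps b' R') = {}"
    if "(a, b, R) \<in> S" "(a', b', R') \<in> S" "(a, b, R) \<noteq> (a', b', R')" for a b R a' b' R'
    using bspec[OF bspec[OF conjunct2[OF assms(8)[unfolded multiplexing_set_def]] that(1),
      unfolded prod.case] that(2)] that(3) by (simp_all only: prod.case simp_thms)
  \<comment> \<open>Distinct triples have disjoint sets of receivers, so no channel lies in two of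
    their classes.\<close>
  have mux_disj: "mux X \<inter> mux X' = {}" if "X \<in> S" "X' \<in> S" "X \<noteq> X'" for X X'
  proof -
    obtain a b R a' b' R' where X: "X = (a, b, R)" "X' = (a', b', R')" by (metis prod_cases3)
    then have "({b} \<union> MAP ps b R) \<inter> ({b'} \<union> MAP ps b' R') = {}"
      using separate(2) that by simp
    moreover have "j \<in> ({b} \<union> MAP ps b R) \<inter> ({b'} \<union> MAP ps b' R')"
      if "(r, i, j) \<in> mux X \<inter> mux X'" for r i j
      using receiver[of a b R r i j] receiver[of a' b' R' r i j] X that \<open>X \<in> S\<close> \<open>X' \<in> S\<close>
      by (simp only: Int_iff simp_thms)
    ultimately show ?thesis by fast
  qed
  \<comment> \<open>In its own triple \<open>a\<close> is no receiver, as it differs from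
    \<open>b\<close> and from every \<open>ps r b\<close>; in the other triples the separation
    condition excludes it.\<close>
  have unmuxed: "(s, p, a) \<notin> \<Union> (mux ` S)" if aS: "(a, b, R) \<in> S" for a b R s p
  proof
    assume "(s, p, a) \<in> \<Union> (mux ` S)"
    then obtain a' b' R' where X: "(a', b', R') \<in> S" "(s, p, a) \<in> mux (a', b', R')"
      by (metis UN_E prod_cases3)
    show False
    proof (cases "(a, b, R) = (a', b', R')")
      case True
      with receiver[OF X] good_tripleD(3,8)[OF good[OF aS]] show ?thesis by auto
    next
      case False
      then have "a \<notin> {b'} \<union> MAP ps b' R'"
        using separate(1) aS X(1) by simp
      with receiver[OF X] show ?thesis by blast
    qed
  qed

  \<comment> \<open>Correctness of the multiplexed simulation\<close>
  have "D_NOF k (multi_strings l n) (multi k l f) \<le> enat ((\<Sum>t = 1..T. \<Sum>c\<in>J. len t c) + l)"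
  proof (rule D_NOF_multi_le[where G = G and Qs = Qs and cls = cls and writer = writer])
    show "restriction_graph k (G r)" if "r \<in> {1..l}" for r
      unfolding G_def using restriction_graph_permuted[OF assms(1) perm[OF that]] .
    show "finite J" by (simp add: J_def S_fin chan_def)
    show cls_sub: "cls c \<subseteq> {1..l} \<times> {1..k} \<times> {1..k}" if "c \<in> J" for c
      unfolding chan_def[symmetric]
      using that by (auto simp: J_def cls_def intro: subsetD[OF mux_chan])
    show "writer c \<in> {1..k}" if "c \<in> J" for c
      using that good_tripleD(1)[OF good] by (auto simp: J_def chan_def writer_def)
    show "i = writer c" if "c \<in> J" "(r, i, j) \<in> cls c" for c r i j
      using that by (auto simp: J_def cls_def writer_def mux_def mux_channels_def)
    show "\<exists>c\<in>J. (r, i, j) \<in> cls c"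
      if "r \<in> {1..l}" "i \<in> {1..k}" "j \<in> {1..k}" for r i j
    proof (cases "(r, i, j) \<in> \<Union> (mux ` S)")
      case True
      then obtain X where "X \<in> S" "(r, i, j) \<in> mux X" by blast
      then show ?thesis by (intro bexI[of _ "Inr X"]) (auto simp: J_def cls_def)
    next
      case False
      with that show ?thesis
        by (intro bexI[of _ "Inl (r, i, j)"]) (auto simp: J_def cls_def chan_def)
    qed
    show "LEN k n (G r) (Qs r) t i j = len t c" if "c \<in> J" "(r, i, j) \<in> cls c" for c r i j t
    proof -
      have "LEN k n (G r) (Qs r) t i j = L t r i j" using Qs(3) cls_sub that by blast
      then show ?thesis using that L_mux by (auto simp: J_def cls_def len_def)
    qed
    show "j \<notin> nbrs (G r') i"
      if c: "c \<in> J" "(r, i, j) \<in> cls c" "(r', i, j') \<in> cls c" "(r, i, j) \<noteq> (r', i, j')"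
      for c r i j r' j'
    proof -
      \<comment> \<open>A class with two distinct channels cannot be a singleton class, so it stems
        from a triple.\<close>
      obtain a b R where X: "(a, b, R) \<in> S" "(r, i, j) \<in> mux (a, b, R)" "(r', i, j') \<in> mux (a, b, R)"
        using c by (auto simp: J_def cls_def)
      note g = good[OF X(1)]
      have "j \<in> non_nbrs k (G r') a"
      \<comment> \<open>The split is on the instance of the message to be recomputed: the second
        goodness condition serves instance 1, the third serves \<open>r' \<in> R\<close>.\<close>
      proof (rule mux_E[OF X(1,3)])
        assume r': "r' = 1" "j' = b"
        have "j \<in> MAP ps b R"
          by (rule mux_E[OF X(1,2)]) (use r' c(4) in \<open>auto simp: MAP_def\<close>)
        with r' show ?thesis using good_tripleD(6)[OF g] G1 by auto
      next
        assume r': "r' \<in> R" "r' \<noteq> 1" "j' = ps r' b"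
        \<comment> \<open>The third condition leaves out \<open>ps r' b\<close>, the receiver of the
          other message; distinct channels of one class never share a receiver.\<close>
        have "j \<noteq> ps r' b"
        proof (rule mux_E[OF X(1,2)])
          assume "j = b"
          moreover have "ps r' b \<in> MAP ps b R" using r'(1) by (simp add: MAP_def)
          ultimately show ?thesis using good_tripleD(9)[OF g] by auto
        next
          assume "r \<in> R" "j = ps r b"
          then show ?thesis using good_triple_inj[OF g _ r'(1), of r] r'(3) c(4) by auto
        qed
        then have "j \<in> MAP ps b R \<union> {b} - {ps r' b}" using receiver[OF X(1,2)] by simp
        then show ?thesis unfolding G_def by (rule subsetD[OF good_tripleD(10)[OF g r'(1)]])
      qed
      moreover have "i = a" using X by (auto simp: mux_def mux_channels_def)
      ultimately show ?thesis by (simp add: non_nbrs_def)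
    qed
    show "\<exists>d\<in>J. cls d = {(s, p, i)}"
      if c: "c \<in> J" "(r, i, j) \<in> cls c" "(r', i, j') \<in> cls c" "(r, i, j) \<noteq> (r', i, j')"
        and s: "s \<in> {1..l}" "p \<in> {1..k}" for c r i j r' j' s p
    proof -
      obtain b R where X: "(i, b, R) \<in> S"
        using c by (auto simp: J_def cls_def mux_def mux_channels_def)
      then have "i \<in> {1..k}" using good_tripleD(1)[OF good] by blast
      with s unmuxed[OF X] show ?thesis
        by (intro bexI[of _ "Inl (s, p, i)"]) (auto simp: J_def cls_def chan_def)
    qed
  qed (use Qs T in auto)
  then have upper: "ereal_of_enat (D_NOF k (multi_strings l n) (multi k l f)) \<le>
      ereal_of_enat (enat ((\<Sum>t = 1..T. \<Sum>c\<in>J. len t c) + l))"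
    by (simp only: ereal_of_enat_le_iff)

  \<comment> \<open>Counting the saved bits\<close>
  have "(\<Sum>t = 1..T. \<Sum>c\<in>J. len t c) + (\<Sum>(a, b, R)\<in>S. card R * W k n E Q a b) =
      l * D_NOF_G k n E Q"
  proof -
    let ?L = "\<lambda>t (r, i, j). L t r i j"
    \<comment> \<open>A permutation of the parties only reindexes the double sum, so in each round
      every instance sends as many bits as \<open>Q\<close>.\<close>
    have instance_sum: "(\<Sum>i = 1..k. \<Sum>j = 1..k. L t r i j) =
        (\<Sum>i = 1..k. \<Sum>j = 1..k. LEN k n E Q t i j)" if "r \<in> {1..l}" for t r
      unfolding L_def
      by (subst (1 2) sum.permute[OF permutes_inv[OF perm[OF that]]]) (simp add: comp_def)
    have chan_sum: "(\<Sum>c\<in>chan. ?L t c) = l * (\<Sum>i = 1..k. \<Sum>j = 1..k. LEN k n E Q t i j)" for t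
      using instance_sum[of _ t] by (simp add: chan_def sum.cartesian_product[symmetric])
    have mux_sum: "(\<Sum>c\<in>mux (a, b, R). ?L t c) = Suc (card R) * LEN k n E Q t a b"
      if "(a, b, R) \<in> S" for a b R t
    proof -
      have "(\<Sum>c\<in>mux (a, b, R). ?L t c) = (\<Sum>c\<in>mux (a, b, R). LEN k n E Q t a b)"
        using L_mux[OF that] by (intro sum.cong) auto
      then show ?thesis
        using card_mux_channels[OF good[OF that] assms(6)] by (simp add: mux_def)
    qed
    \<comment> \<open>For each triple, \<open>card R + 1\<close> equal lengths shrink to one. The
      identity is kept additive because subtraction of naturals truncates.\<close>
    have round_sum: "(\<Sum>c\<in>J. len t c) + (\<Sum>(a, b, R)\<in>S. card R * LEN k n E Q t a b) =
        l * (\<Sum>i = 1..k. \<Sum>j = 1..k. LEN k n E Q t i j)" for t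
    proof -
      have fin: "finite chan" by (simp add: chan_def)
      have "(\<Sum>c\<in>chan. ?L t c) = (\<Sum>c\<in>chan - \<Union> (mux ` S). ?L t c) + (\<Sum>c\<in>\<Union> (mux ` S). ?L t c)"
        by (rule sum.subset_diff[OF mux_sub fin])
      also have "(\<Sum>c\<in>\<Union> (mux ` S). ?L t c) = (\<Sum>X\<in>S. \<Sum>c\<in>mux X. ?L t c)"
        using S_fin mux_disj finite_subset[OF mux_chan fin] by (intro sum.UNION_disjoint) auto
      also have "\<dots> = (\<Sum>(a, b, R)\<in>S. LEN k n E Q t a b + card R * LEN k n E Q t a b)"
        using mux_sum by (intro sum.cong) auto
      also have "\<dots> = (\<Sum>(a, b, R)\<in>S. LEN k n E Q t a b) + (\<Sum>(a, b, R)\<in>S. card R * LEN k n E Q t a b)"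
        by (simp add: sum.distrib case_prod_beta)
      finally show ?thesis
        using fin S_fin by (simp add: chan_sum J_def len_def sum.Plus)
    qed
    have W: "W k n E Q i j = (\<Sum>t = 1..T. LEN k n E Q t i j)"
      if "i \<in> {1..k}" "j \<in> {1..k}" for i j
      using W_eq_sum[OF assms(2) T(1) that] .
    have "D_NOF_G k n E Q = (\<Sum>i = 1..k. \<Sum>t = 1..T. \<Sum>j = 1..k. LEN k n E Q t i j)"
      unfolding D_NOF_G_def by (subst (2) sum.swap) (simp add: W)
    also have "\<dots> = (\<Sum>t = 1..T. \<Sum>i = 1..k. \<Sum>j = 1..k. LEN k n E Q t i j)"
      by (rule sum.swap)
    finally have D: "D_NOF_G k n E Q = \<dots>" .
    have "(\<Sum>(a, b, R)\<in>S. card R * W k n E Q a b) =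
        (\<Sum>X\<in>S. \<Sum>t = 1..T. (\<lambda>(a, b, R). card R * LEN k n E Q t a b) X)"
      using good_tripleD(1,2)[OF good] by (intro sum.cong) (auto simp: W sum_distrib_left)
    also have "\<dots> = (\<Sum>t = 1..T. \<Sum>(a, b, R)\<in>S. card R * LEN k n E Q t a b)"
      by (rule sum.swap)
    finally show ?thesis
      using round_sum by (simp add: D sum.distrib[symmetric] sum_distrib_left[symmetric])
  qed
  then have "real (\<Sum>t = 1..T. \<Sum>c\<in>J. len t c) + real (\<Sum>(a, b, R)\<in>S. card R * W k n E Q a b) =
      real l * real (D_NOF_G k n E Q)"
    by (metis of_nat_add of_nat_mult)
  moreover have "real (\<Sum>(a, b, R)\<in>S. card R * W k n E Q a b) =
      (\<Sum>(a, b, R)\<in>S. real (card R) * real (W k n E Q a b))"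
    by (simp add: case_prod_beta)
  ultimately have "real ((\<Sum>t = 1..T. \<Sum>c\<in>J. len t c) + l) =
      real l * real (D_NOF_G k n E Q) + real l
        - (\<Sum>(a, b, R)\<in>S. real (card R) * real (W k n E Q a b))"
    by linarith
  with upper show ?thesis by (simp only: ereal_of_enat_simps)
qed

end
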